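(* Let $\beta<1$ be real and let $f(z)=z+\sum_{n=2}^{\infty}a_nz^n\in\mathcal{F}_2(\beta)$. Then for all integers $n,m\ge2$ that are not both even, and all real $$\mu\ge\max\left\{\frac{nm}{(n+m-1)(1-\beta)},\ \frac{nm}{n+m-1}\right\},$$ we have $$|\mu a_na_m-a_{n+m-1}|\le\mu C_nC_m-C_{n+m-1},$$ where, for $n\ge2$, $$C_n=\begin{cases}\dfrac{1+(n-1)(1-\beta)}{n}, & n \text{ odd},\\[2mm] 1-\beta, & n\text{ even}.\end{cases}$$ The result is sharp: for every such $\beta,n,m,\mu$, equality is attained by some function in $\mathcal{F}_2(\beta)$.
   Context: $\mathbb{D}$ is the open unit disc and $\mathcal{A}$ is the class of analytic functions on $\mathbb{D}$ of the form $f(z)=z+a_2z^2+a_3z^3+\cdots$. For real $\beta<1$, $\mathcal{F}_2(\beta)$ is the class of $f\in\mathcal{A}$ with $\operatorname{Re}\big((1-z^2)f'(z)\big)>\beta$ for all $z\in\mathbb{D}$. *)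

theory Defs
  imports "HOL-Complex_Analysis.Complex_Analysis"
begin

text \<open>
  The expansion \<open>f z = z + a\<^sub>2 z\<^sup>2 + a\<^sub>3 z\<^sup>3 + \<dots>\<close> on the open unit disc.
  The values \<open>a 0\<close> and \<open>a 1\<close> are not constrained.
\<close>
definition has_expansion :: "(complex \<Rightarrow> complex) \<Rightarrow> (nat \<Rightarrow> complex) \<Rightarrow> bool" where
  "has_expansion f a \<longleftrightarrow>
     (\<forall>z\<in>ball 0 1. (\<lambda>k. a (k + 2) * z ^ (k + 2)) sums (f z - z))"

definition class_A :: "(complex \<Rightarrow> complex) set" where
  "class_A = {f. f analytic_on ball 0 1 \<and> (\<exists>a. has_expansion f a)}"

definition class_F2 :: "real \<Rightarrow> (complex \<Rightarrow> complex) set" where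
  "class_F2 \<beta> = {f \<in> class_A. \<forall>z\<in>ball 0 1. Re ((1 - z\<^sup>2) * deriv f z) > \<beta>}"

definition C :: "real \<Rightarrow> nat \<Rightarrow> real" where
  "C \<beta> n = (if odd n then (1 + (real n - 1) * (1 - \<beta>)) / real n else 1 - \<beta>)"

end

theory Submission
  imports Defs
begin

text \<open>
  Put \<open>b = 1 - \<beta>\<close>. Membership of \<open>f\<close> in the class says that
  \<open>(1 - z\<^sup>2) f' z = \<beta> + b p z\<close> for some \<open>p z = 1 + \<Sum> c\<^sub>k z\<^sup>k\<close> with positive real part.
  Dividing by \<open>1 - z\<^sup>2\<close> adds up the coefficients \<open>c\<^sub>k\<close> along a parity class: with
  \<open>S\<^sub>l = c\<^sub>2 + c\<^sub>4 + \<dots> + c\<^sub>2\<^sub>l\<close> and \<open>T\<^sub>k = c\<^sub>1 + c\<^sub>3 + \<dots>\<close> (\<open>k\<close> terms), the number \<open>n a\<^sub>n\<close> is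
  \<open>1 + b S\<^sub>l\<close> for \<open>n = 2 l + 1\<close> and \<open>b T\<^sub>k\<close> for \<open>n = 2 k\<close> (\<open>class_F2_coefficients\<close>).

  Two inequalities are needed for the \<open>c\<^sub>k\<close>: the classical \<open>\<bar>c\<^sub>k\<bar> \<le> 2\<close>, and Livingston's
  \<open>\<bar>c\<^sub>i c\<^sub>j - c\<^sub>i\<^sub>+\<^sub>j\<bar> \<le> 2\<close>. Both hold because \<open>c\<^sub>k r\<^sup>k / 2\<close> is a moment of the probability density
  \<open>Re p\<close> on the circle of radius \<open>r < 1\<close>.

  Multiplied by \<open>n + m - 1\<close> and with \<open>L = \<mu> (n + m - 1) / (n m)\<close>, the functional becomes
  \<open>L (n a\<^sub>n) (m a\<^sub>m) - (n + m - 1) a\<^sub>n\<^sub>+\<^sub>m\<^sub>-\<^sub>1\<close>. The hypothesis on \<open>\<mu>\<close> says that \<open>L \<ge> 1\<close> and \<open>L b \<ge> 1\<close>.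
  These are the sign conditions under which the functional splits into a combination, with
  nonnegative weights, of terms that are bounded by \<open>\<bar>c\<^sub>k\<bar> \<le> 2\<close> alone and of one combination without
  parameters, \<open>S\<^sub>k S\<^sub>l + S\<^sub>k + S\<^sub>l - S\<^sub>k\<^sub>+\<^sub>l\<close> if both indices are odd and \<open>T\<^sub>k S\<^sub>l + T\<^sub>k - T\<^sub>k\<^sub>+\<^sub>l\<close> if one is
  even. There each coefficient entering with a minus sign can be paired with a product of two
  coefficients so that Livingston's inequality applies. All these estimates are equalities when
  every \<open>c\<^sub>k\<close> with \<open>k \<ge> 1\<close> equals 2, that is for \<open>p z = (1 + z) / (1 - z)\<close>, which is why the bound is
  attained there, the coefficients of \<open>f\<close> being \<open>C \<beta> n\<close>.
\<close>

section \<open>Coefficients of functions with positive real part\<close>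

lemma power_series_imp_holomorphic:
  fixes p :: "complex \<Rightarrow> complex"
  assumes "\<And>z. z \<in> ball 0 1 \<Longrightarrow> (\<lambda>k. c k * z ^ k) sums p z"
  shows "p holomorphic_on ball 0 1"
  by (rule power_series_holomorphic[where a = c]) (use assms in auto)

text \<open>
  Parametrised by the circle of radius \<open>r\<close>, Cauchy's formula for the derivatives at the centre gives
  the first mean; Cauchy's theorem for \<open>p z * z ^ (k - 1)\<close> gives the second.
\<close>

lemma circle_means:
  fixes p :: "complex \<Rightarrow> complex" and r :: real
  assumes ps: "\<And>z. z \<in> ball 0 1 \<Longrightarrow> (\<lambda>k. c k * z ^ k) sums p z"
    and r: "0 < r" "r < 1"
  shows "((\<lambda>t. p (of_real r * cis (2 * pi * t)) * cnj (cis (2 * pi * t)) ^ k)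
           has_integral c k * of_real r ^ k) {0..1}" (is ?coeff)
    and "k \<ge> 1 \<Longrightarrow> ((\<lambda>t. p (of_real r * cis (2 * pi * t)) * cis (2 * pi * t) ^ k)
           has_integral 0) {0..1}" (is "_ \<Longrightarrow> ?zero")
proof -
  have hol: "p holomorphic_on ball 0 1"
    by (rule power_series_imp_holomorphic[OF ps])
  have circ: "circlepath 0 r t = of_real r * cis (2 * pi * t)" for t
    by (simp add: circlepath cis_conv_exp mult_ac)
  have dcirc: "vector_derivative (circlepath 0 r) (at t within {0..1})
      = 2 * pi * \<i> * (of_real r * cis (2 * pi * t))" if "t \<in> {0..1}" for t
    using that by (simp add: vector_derivative_circlepath01 cis_conv_exp mult_ac)
  have "p has_fps_expansion Abs_fps c"
  proof (rule has_fps_expansionI)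
    have "eventually (\<lambda>u. u \<in> ball 0 1) (nhds (0::complex))"
      by (rule eventually_nhds_in_open) auto
    thus "eventually (\<lambda>u. (\<lambda>n. fps_nth (Abs_fps c) n * u ^ n) sums p u) (nhds 0)"
      by eventually_elim (use ps in auto)
  qed
  hence ck: "c k = (deriv ^^ k) p 0 / fact k"
    by (metis fps_nth_Abs_fps fps_nth_fps_expansion)
  have "((\<lambda>u. p u / (u - 0) ^ Suc k) has_contour_integral
          (2 * pi * \<i>) / fact k * (deriv ^^ k) p 0) (circlepath 0 r)"
  proof (rule Cauchy_has_contour_integral_higher_derivative_circlepath)
    show "continuous_on (cball 0 r) p"
      by (rule continuous_on_subset[OF holomorphic_on_imp_continuous_on[OF hol]]) (use r in auto)
    show "p holomorphic_on ball 0 r"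
      by (rule holomorphic_on_subset[OF hol]) (use r in auto)
  qed (use r in auto)
  hence "((\<lambda>t. p (of_real r * cis (2 * pi * t)) / (of_real r * cis (2 * pi * t)) ^ Suc k
            * (2 * pi * \<i> * (of_real r * cis (2 * pi * t))))
          has_integral (2 * pi * \<i>) * c k) {0..1}"
    unfolding has_contour_integral_def using dcirc
    by (subst has_integral_cong[where g = "\<lambda>x. p (circlepath 0 r x) / (circlepath 0 r x - 0) ^ Suc k *
           vector_derivative (circlepath 0 r) (at x within {0..1})"])
       (auto simp: circ ck)
  hence "((\<lambda>t. of_real r ^ k / (2 * pi * \<i>) * (p (of_real r * cis (2 * pi * t))
            / (of_real r * cis (2 * pi * t)) ^ Suc k
            * (2 * pi * \<i> * (of_real r * cis (2 * pi * t)))))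
          has_integral of_real r ^ k / (2 * pi * \<i>) * ((2 * pi * \<i>) * c k)) {0..1}"
    by (rule has_integral_mult_right)
  moreover have "of_real r ^ k / (2 * pi * \<i>) * (P / (of_real r * cis s) ^ Suc k
            * (2 * pi * \<i> * (of_real r * cis s))) = P * cnj (cis s) ^ k" for P s
  proof -
    have "cnj (cis s) ^ k = 1 / cis s ^ k"
      by (simp add: cis_cnj field_simps flip: power_mult_distrib cis_mult)
         (simp add: cis_mult)
    thus ?thesis
      using r by (simp add: field_simps power_mult_distrib)
  qed
  ultimately have "((\<lambda>t. p (of_real r * cis (2 * pi * t)) * cnj (cis (2 * pi * t)) ^ k)
      has_integral of_real r ^ k / (2 * pi * \<i>) * ((2 * pi * \<i>) * c k)) {0..1}"
    by (simp only:)
  thus ?coeff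
    by (simp add: mult.commute)
  show ?zero if k: "k \<ge> 1"
  proof -
    have "((\<lambda>u. p u * u ^ (k - 1)) has_contour_integral 0) (circlepath 0 r)"
      by (rule Cauchy_theorem_convex_simple[where S = "ball 0 1"])
         (use r in \<open>auto intro!: holomorphic_intros hol\<close>)
    hence "((\<lambda>t. p (of_real r * cis (2 * pi * t)) * (of_real r * cis (2 * pi * t)) ^ (k - 1)
              * (2 * pi * \<i> * (of_real r * cis (2 * pi * t))))
            has_integral 0) {0..1}"
      unfolding has_contour_integral_def using dcirc
      by (subst has_integral_cong[where g = "\<lambda>x. p (circlepath 0 r x) * circlepath 0 r x ^ (k - 1) *
           vector_derivative (circlepath 0 r) (at x within {0..1})"])
         (auto simp: circ)
    hence "((\<lambda>t. 1 / (2 * pi * \<i> * of_real r ^ k) * (p (of_real r * cis (2 * pi * t))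
              * (of_real r * cis (2 * pi * t)) ^ (k - 1)
              * (2 * pi * \<i> * (of_real r * cis (2 * pi * t)))))
            has_integral 1 / (2 * pi * \<i> * of_real r ^ k) * 0) {0..1}"
      by (rule has_integral_mult_right)
    moreover have "1 / (2 * pi * \<i> * of_real r ^ k) * (P * (of_real r * cis s) ^ (k - 1)
              * (2 * pi * \<i> * (of_real r * cis s))) = P * cis s ^ k" for P s
      using r k by (cases k) (simp_all add: field_simps power_mult_distrib)
    ultimately show ?thesis
      by simp
  qed
qed

text \<open>
  Writing \<open>Re p\<close> as \<open>(p + cnj p) / 2\<close>, only the first half contributes: the other is the
  conjugate of the vanishing mean in \<open>circle_means\<close>. That second half does contribute for \<open>k = 0\<close>,
  which is therefore treated separately.
\<close>

lemma real_part_circle_means: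
  fixes p :: "complex \<Rightarrow> complex" and r :: real
  assumes ps: "\<And>z. z \<in> ball 0 1 \<Longrightarrow> (\<lambda>k. c k * z ^ k) sums p z"
    and r: "0 < r" "r < 1" and k: "k \<ge> 1"
  shows "((\<lambda>t. of_real (Re (p (of_real r * cis (2 * pi * t)))) * cnj (cis (2 * pi * t)) ^ k)
           has_integral c k * of_real r ^ k / 2) {0..1}"
proof -
  let ?p = "\<lambda>t. p (of_real r * cis (2 * pi * t))"
  have 1: "((\<lambda>t. ?p t * cnj (cis (2 * pi * t)) ^ k) has_integral c k * of_real r ^ k) {0..1}"
    by (rule circle_means(1)[OF ps r])
  have "(cnj \<circ> (\<lambda>t. ?p t * cis (2 * pi * t) ^ k) has_integral cnj 0) {0..1}"
    unfolding has_integral_cnj by (rule circle_means(2)[OF ps r k])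
  hence 2: "((\<lambda>t. cnj (?p t) * cnj (cis (2 * pi * t)) ^ k) has_integral 0) {0..1}"
    by (simp add: o_def)
  have "(P * x + cnj P * x) / 2 = of_real (Re P) * x" for P x :: complex
    by (simp add: complex_add_cnj flip: distrib_right)
  thus ?thesis
    using has_integral_divide[OF has_integral_add[OF 1 2], of 2] by (simp only: add_0_right)
qed

lemma real_part_circle_mean_total:
  fixes p :: "complex \<Rightarrow> complex" and r :: real
  assumes ps: "\<And>z. z \<in> ball 0 1 \<Longrightarrow> (\<lambda>k. c k * z ^ k) sums p z"
    and c0: "c 0 = 1" and r: "0 < r" "r < 1"
  shows "((\<lambda>t. Re (p (of_real r * cis (2 * pi * t)))) has_integral 1) {0..1}"
  using has_integral_Re[OF circle_means(1)[OF ps r, of 0]] c0 by simp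

lemma le_if_le_power_mult:
  fixes x y :: real
  assumes "\<And>r. 0 < r \<Longrightarrow> r < 1 \<Longrightarrow> x * r ^ k \<le> y"
  shows "x \<le> y"
proof -
  have "((\<lambda>r. x * r ^ k) \<longlongrightarrow> x * 1 ^ k) (at_left (1::real))"
    by (intro tendsto_intros)
  moreover have "eventually (\<lambda>r::real. r \<in> {0<..<1}) (at_left 1)"
    by (rule eventually_at_left_real) simp
  hence "eventually (\<lambda>r. x * r ^ k \<le> y) (at_left 1)"
    by eventually_elim (use assms in auto)
  ultimately show ?thesis
    using tendsto_upperbound[of "\<lambda>r. x * r ^ k" "x * 1 ^ k" "at_left 1" y] by simp
qed

text \<open>
  A moment of a probability density on the unit circle has modulus at most 1; this gives
  \<open>\<bar>c k\<bar> * r ^ k / 2 \<le> 1\<close>, and then \<open>r\<close> tends to 1.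
\<close>

lemma caratheodory_coeff_bound:
  fixes p :: "complex \<Rightarrow> complex"
  assumes ps: "\<And>z. z \<in> ball 0 1 \<Longrightarrow> (\<lambda>k. c k * z ^ k) sums p z"
    and c0: "c 0 = 1" and pos: "\<And>z. z \<in> ball 0 1 \<Longrightarrow> Re (p z) > 0" and k: "k \<ge> 1"
  shows "cmod (c k) \<le> 2"
proof (rule le_if_le_power_mult)
  fix r :: real
  assume r: "0 < r" "r < 1"
  define w where "w t = Re (p (of_real r * cis (2 * pi * t)))" for t
  have w: "w t > 0" for t
    unfolding w_def by (rule pos) (use r in \<open>auto simp: norm_mult\<close>)
  have total: "(w has_integral 1) {0..1}"
    unfolding w_def by (rule real_part_circle_mean_total[OF ps c0 r])
  have mean: "((\<lambda>t. of_real (w t) * cnj (cis (2 * pi * t)) ^ k)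
                 has_integral c k * of_real r ^ k / 2) {0..1}"
    unfolding w_def by (rule real_part_circle_means[OF ps r k])
  have "norm (integral {0..1} (\<lambda>t. of_real (w t) * cnj (cis (2 * pi * t)) ^ k)) \<le> integral {0..1} w"
    by (rule integral_norm_bound_integral)
       (use total mean w in \<open>auto simp: norm_mult norm_power intro: less_imp_le abs_of_pos has_integral_integrable\<close>)
  hence "cmod (c k * of_real r ^ k / 2) \<le> 1"
    using total mean by (simp add: integral_unique)
  thus "cmod (c k) * r ^ k \<le> 2"
    using r by (simp add: norm_mult norm_divide norm_power)
qed

text \<open>
  Let \<open>M k\<close> be the moments \<open>\<integral> w u\<^sup>k\<close> of the probability density \<open>w\<close>, where \<open>\<bar>u\<bar> = 1\<close>. Then
  \<open>2 M\<^sub>i M\<^sub>j - M\<^sub>i\<^sub>+\<^sub>j = \<integral> w u\<^sup>i (2 M\<^sub>j - u\<^sup>j)\<close>. The reflected variable \<open>2 M\<^sub>j - u\<^sup>j\<close> has the same mean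
  square 1 as \<open>u\<^sup>j\<close>, since \<open>M\<^sub>j\<close> is the mean of \<open>u\<^sup>j\<close>. So the integral has modulus at most 1.
\<close>

lemma livingston_inequality:
  fixes p :: "complex \<Rightarrow> complex"
  assumes ps: "\<And>z. z \<in> ball 0 1 \<Longrightarrow> (\<lambda>k. c k * z ^ k) sums p z"
    and c0: "c 0 = 1" and pos: "\<And>z. z \<in> ball 0 1 \<Longrightarrow> Re (p z) > 0"
    and i: "i \<ge> 1" and j: "j \<ge> 1"
  shows "cmod (c i * c j - c (i + j)) \<le> 2"
proof (rule le_if_le_power_mult)
  fix r :: real
  assume r: "0 < r" "r < 1"
  define w where "w t = Re (p (of_real r * cis (2 * pi * t)))" for t
  define u where "u t = cnj (cis (2 * pi * t))" for t
  define M where "M k = c k * of_real r ^ k / 2" for k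
  have w: "w t > 0" for t
    unfolding w_def by (rule pos) (use r in \<open>auto simp: norm_mult\<close>)
  have u: "cmod (u t) = 1" for t
    by (simp add: u_def)
  have total: "(w has_integral 1) {0..1}"
    unfolding w_def by (rule real_part_circle_mean_total[OF ps c0 r])
  have mean: "((\<lambda>t. of_real (w t) * u t ^ k) has_integral M k) {0..1}" if "k \<ge> 1" for k
    unfolding w_def u_def M_def by (rule real_part_circle_means[OF ps r that])
  \<comment> \<open>\<open>F\<close> is \<open>w u\<^sup>i (2 M\<^sub>j - u\<^sup>j)\<close>, and \<open>G\<close> is \<open>w \<bar>2 M\<^sub>j - u\<^sup>j\<bar>\<^sup>2 / 2\<close> multiplied out, so that both integrate
      by linearity.\<close>
  define F where "F t = 2 * M j * (of_real (w t) * u t ^ i) - of_real (w t) * u t ^ (i + j)" for t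
  define G where "G t = (1/2 + 2 * (cmod (M j))\<^sup>2) * w t - 2 * Re (cnj (M j) * (of_real (w t) * u t ^ j))" for t
  have F: "(F has_integral 2 * M j * M i - M (i + j)) {0..1}"
    unfolding F_def using i j by (intro has_integral_diff has_integral_mult_right mean) auto
  have "(G has_integral (1/2 + 2 * (cmod (M j))\<^sup>2) * 1 - 2 * Re (cnj (M j) * M j)) {0..1}"
    unfolding G_def using i j
    by (intro has_integral_diff has_integral_mult_right mean total has_integral_Re) auto
  hence "(G has_integral 1/2 + 2 * (cmod (M j))\<^sup>2 - 2 * Re (cnj (M j) * M j)) {0..1}"
    by simp
  moreover have "Re (cnj (M j) * M j) = (cmod (M j))\<^sup>2"
    unfolding cmod_power2 by (simp add: power2_eq_square)
  ultimately have G: "(G has_integral 1/2) {0..1}"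
    by (simp only: add_diff_cancel_right')
  have FG: "cmod (F t) \<le> w t / 2 + G t" for t
  proof -
    define U where "U = u t ^ j"
    have U: "(Re U)\<^sup>2 + (Im U)\<^sup>2 = 1"
      by (simp add: U_def norm_power u flip: cmod_power2)
    have "F t = of_real (w t) * u t ^ i * (2 * M j - U)"
      by (simp add: F_def U_def power_add algebra_simps)
    hence "cmod (F t) = w t * cmod (2 * M j - U)"
      using w[of t] by (simp add: norm_mult norm_power u)
    \<comment> \<open>\<open>x \<le> (1 + x\<^sup>2) / 2\<close> loses nothing after integration, the mean square being 1; it replaces the
        Cauchy-Schwarz inequality.\<close>
    also have "\<dots> \<le> w t * ((1 + (cmod (2 * M j - U))\<^sup>2) / 2)"
    proof (rule mult_left_mono)
      have "0 \<le> (cmod (2 * M j - U) - 1)\<^sup>2"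
        by simp
      thus "cmod (2 * M j - U) \<le> (1 + (cmod (2 * M j - U))\<^sup>2) / 2"
        by (simp add: power2_eq_square algebra_simps)
    qed (use w[of t] in simp)
    also have "(cmod (2 * M j - U))\<^sup>2
        = 4 * (cmod (M j))\<^sup>2 - 4 * Re (cnj (M j) * U) + ((Re U)\<^sup>2 + (Im U)\<^sup>2)"
      unfolding cmod_power2 by (simp add: power2_eq_square algebra_simps)
    also have "w t * ((1 + (4 * (cmod (M j))\<^sup>2 - 4 * Re (cnj (M j) * U) + ((Re U)\<^sup>2 + (Im U)\<^sup>2))) / 2)
        = w t / 2 + G t"
      unfolding U G_def U_def[symmetric] by (simp add: field_simps)
    finally show ?thesis .
  qed
  have "norm (integral {0..1} F) \<le> integral {0..1} (\<lambda>t. w t / 2 + G t)"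
    by (rule integral_norm_bound_integral)
       (use F G total FG in \<open>auto intro!: integrable_add integrable_on_divide\<close>)
  also have "integral {0..1} (\<lambda>t. w t / 2 + G t) = 1 / 2 + 1 / 2"
    by (intro integral_unique has_integral_add has_integral_divide total G)
  also have "integral {0..1} F = (c i * c j - c (i + j)) * of_real r ^ (i + j) / 2"
    using F by (simp add: integral_unique M_def power_add field_simps)
  finally show "cmod (c i * c j - c (i + j)) * r ^ (i + j) \<le> 2"
    using r by (simp add: norm_mult norm_divide norm_power)
qed


section \<open>Sums of coefficients along a parity class\<close>

definition even_coeff_sum :: "(nat \<Rightarrow> complex) \<Rightarrow> nat \<Rightarrow> complex" where
  "even_coeff_sum c l = (\<Sum>i = 1..l. c (2 * i))"

definition odd_coeff_sum :: "(nat \<Rightarrow> complex) \<Rightarrow> nat \<Rightarrow> complex" where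
  "odd_coeff_sum c k = (\<Sum>i<k. c (2 * i + 1))"

lemma norm_even_coeff_sum_le:
  assumes "\<And>k. k \<ge> 1 \<Longrightarrow> cmod (c k) \<le> 2"
  shows "cmod (even_coeff_sum c l) \<le> 2 * real l"
  using sum_norm_bound[of "{1..l}" "\<lambda>i. c (2 * i)" 2] assms by (simp add: even_coeff_sum_def)

lemma norm_odd_coeff_sum_le:
  assumes "\<And>k. k \<ge> 1 \<Longrightarrow> cmod (c k) \<le> 2"
  shows "cmod (odd_coeff_sum c k) \<le> 2 * real k"
  using sum_norm_bound[of "{..<k}" "\<lambda>i. c (2 * i + 1)" 2] assms by (simp add: odd_coeff_sum_def)

lemma even_coeff_sum_add:
  "even_coeff_sum c (l + k) = even_coeff_sum c l + (\<Sum>i = 1..k. c (2 * l + 2 * i))"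
  by (induction k) (simp_all add: even_coeff_sum_def algebra_simps)

text \<open>
  The new terms are written as \<open>c (2 * k - 1 + 2 * i)\<close>, with the last index \<open>2 * k - 1\<close> of
  \<open>odd_coeff_sum c k\<close>, so that they fit Livingston's inequality for \<open>c (2 * k - 1) * c (2 * i)\<close>.
\<close>

lemma odd_coeff_sum_add:
  assumes "k \<ge> 1"
  shows "odd_coeff_sum c (k + l) = odd_coeff_sum c k + (\<Sum>i = 1..l. c (2 * k - 1 + 2 * i))"
proof (induction l)
  case (Suc l)
  have "2 * (k + l) + 1 = 2 * k - 1 + 2 * Suc l"
    using assms by simp
  thus ?case
    using Suc by (simp add: odd_coeff_sum_def add.assoc)
qed simp

text \<open>
  Cancelling \<open>S\<^sub>l\<close> against the beginning of \<open>S\<^sub>k\<^sub>+\<^sub>l\<close> leaves the \<open>k\<close> terms \<open>- c\<^sub>2\<^sub>l\<^sub>+\<^sub>2\<^sub>i\<close>. Each is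
  paired with the product \<open>c\<^sub>2\<^sub>l c\<^sub>2\<^sub>i\<close> from \<open>S\<^sub>k S\<^sub>l\<close> at a cost of 2 by Livingston's inequality. The other
  \<open>k (l - 1)\<close> products cost 4 each and the remaining \<open>S\<^sub>k\<close> costs \<open>2 k\<close>, in total \<open>4 k l\<close>.
\<close>

lemma even_even_coeff_sum_bound:
  assumes b1: "\<And>k. k \<ge> 1 \<Longrightarrow> cmod (c k) \<le> 2"
    and b2: "\<And>i j. i \<ge> 1 \<Longrightarrow> j \<ge> 1 \<Longrightarrow> cmod (c i * c j - c (i + j)) \<le> 2"
    and l: "l \<ge> 1"
  shows "cmod (even_coeff_sum c k * even_coeff_sum c l + even_coeff_sum c k + even_coeff_sum c l
           - even_coeff_sum c (k + l)) \<le> 4 * real k * real l"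
proof -
  obtain l' where l': "l = Suc l'"
    using l by (cases l) auto
  let ?S = "even_coeff_sum c"
  have nS: "cmod (?S j) \<le> 2 * real j" for j
    by (rule norm_even_coeff_sum_le[OF b1])
  have S_l: "?S l = ?S l' + c (2 * l)"
    by (simp add: l' even_coeff_sum_def)
  have "(\<Sum>i = 1..k. c (2 * l) * c (2 * i) - c (2 * l + 2 * i))
      = c (2 * l) * ?S k - (\<Sum>i = 1..k. c (2 * l + 2 * i))"
    by (simp add: even_coeff_sum_def sum_distrib_left sum_subtractf)
  hence split: "?S k * ?S l + ?S k + ?S l - ?S (k + l)
      = ?S k * ?S l' + ?S k + (\<Sum>i = 1..k. c (2 * l) * c (2 * i) - c (2 * l + 2 * i))"
    unfolding add.commute[of k l] even_coeff_sum_add[of c l k]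
    by (simp add: S_l algebra_simps)
  have "cmod (?S k * ?S l + ?S k + ?S l - ?S (k + l))
      \<le> cmod (?S k) * cmod (?S l') + cmod (?S k)
        + cmod (\<Sum>i = 1..k. c (2 * l) * c (2 * i) - c (2 * l + 2 * i))"
    unfolding split by (intro norm_triangle_mono order_refl) (simp_all only: norm_mult order_refl)
  also have "\<dots> \<le> (2 * real k) * (2 * real l') + 2 * real k + real (card {1..k}) * 2"
  proof (intro add_mono)
    show "cmod (?S k) * cmod (?S l') \<le> (2 * real k) * (2 * real l')"
      by (rule mult_mono[OF nS nS]) simp_all
    show "cmod (\<Sum>i = 1..k. c (2 * l) * c (2 * i) - c (2 * l + 2 * i)) \<le> real (card {1..k}) * 2"
    proof (rule sum_norm_bound)
      fix i assume "i \<in> {1..k}"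
      thus "cmod (c (2 * l) * c (2 * i) - c (2 * l + 2 * i)) \<le> 2"
        by (intro b2) (use l in auto)
    qed
  qed (rule nS)
  also have "\<dots> = 4 * real k * real l"
    by (simp add: l' algebra_simps)
  finally show ?thesis .
qed

text \<open>
  The same pairing: cancelling \<open>T\<^sub>k\<close> leaves the \<open>l\<close> terms \<open>- c\<^sub>2\<^sub>k\<^sub>-\<^sub>1\<^sub>+\<^sub>2\<^sub>i\<close>, paired with
  \<open>c\<^sub>2\<^sub>k\<^sub>-\<^sub>1 c\<^sub>2\<^sub>i\<close> at a cost of 2 each; the other \<open>(k - 1) l\<close> products cost 4 each.
\<close>

lemma odd_even_coeff_sum_bound:
  assumes b1: "\<And>k. k \<ge> 1 \<Longrightarrow> cmod (c k) \<le> 2"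
    and b2: "\<And>i j. i \<ge> 1 \<Longrightarrow> j \<ge> 1 \<Longrightarrow> cmod (c i * c j - c (i + j)) \<le> 2"
    and k: "k \<ge> 1"
  shows "cmod (odd_coeff_sum c k * even_coeff_sum c l + odd_coeff_sum c k
           - odd_coeff_sum c (k + l)) \<le> 4 * real k * real l - 2 * real l"
proof -
  obtain k' where k': "k = Suc k'"
    using k by (cases k) auto
  let ?S = "even_coeff_sum c" and ?T = "odd_coeff_sum c"
  have nS: "cmod (?S j) \<le> 2 * real j" for j
    by (rule norm_even_coeff_sum_le[OF b1])
  have nT: "cmod (?T j) \<le> 2 * real j" for j
    by (rule norm_odd_coeff_sum_le[OF b1])
  have T_k: "?T k = ?T k' + c (2 * k - 1)"
    by (simp add: k' odd_coeff_sum_def)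
  have "(\<Sum>i = 1..l. c (2 * k - 1) * c (2 * i) - c (2 * k - 1 + 2 * i))
      = c (2 * k - 1) * ?S l - (\<Sum>i = 1..l. c (2 * k - 1 + 2 * i))"
    by (simp add: even_coeff_sum_def sum_distrib_left sum_subtractf)
  hence split: "?T k * ?S l + ?T k - ?T (k + l)
      = ?T k' * ?S l + (\<Sum>i = 1..l. c (2 * k - 1) * c (2 * i) - c (2 * k - 1 + 2 * i))"
    unfolding odd_coeff_sum_add[OF k] by (simp add: T_k algebra_simps)
  have "cmod (?T k * ?S l + ?T k - ?T (k + l))
      \<le> cmod (?T k') * cmod (?S l)
        + cmod (\<Sum>i = 1..l. c (2 * k - 1) * c (2 * i) - c (2 * k - 1 + 2 * i))"
    unfolding split by (intro norm_triangle_mono order_refl) (simp_all only: norm_mult order_refl)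
  also have "\<dots> \<le> (2 * real k') * (2 * real l) + real (card {1..l}) * 2"
  proof (intro add_mono)
    show "cmod (?T k') * cmod (?S l) \<le> (2 * real k') * (2 * real l)"
      by (rule mult_mono[OF nT nS]) simp_all
    show "cmod (\<Sum>i = 1..l. c (2 * k - 1) * c (2 * i) - c (2 * k - 1 + 2 * i)) \<le> real (card {1..l}) * 2"
    proof (rule sum_norm_bound)
      fix i assume "i \<in> {1..l}"
      thus "cmod (c (2 * k - 1) * c (2 * i) - c (2 * k - 1 + 2 * i)) \<le> 2"
        by (intro b2) (use k in auto)
    qed
  qed
  also have "\<dots> = 4 * real k * real l - 2 * real l"
    by (simp add: k' algebra_simps)
  finally show ?thesis .
qed

section \<open>Splitting the functional with nonnegative weights\<close>

lemma norm_lincomb_le: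
  fixes u v w :: complex and s t r :: real
  assumes "0 \<le> s" "0 \<le> t" "0 \<le> r" "cmod u \<le> x" "cmod v \<le> y" "cmod w \<le> z"
  shows "cmod (of_real s * u + of_real t * v + of_real r * w) \<le> s * x + t * y + r * z"
proof -
  have "cmod (of_real s * u + of_real t * v + of_real r * w) \<le> s * cmod u + t * cmod v + r * cmod w"
    using assms by (intro norm_triangle_mono) (simp_all add: norm_mult)
  also have "\<dots> \<le> s * x + t * y + r * z"
    using assms by (intro add_mono mult_left_mono)
  finally show ?thesis .
qed

text \<open>
  The weights \<open>L - 1\<close>, \<open>b (L b - 1)\<close> and \<open>b\<close> of the split are nonnegative exactly because of the
  assumptions on \<open>L\<close>, and the right-hand side splits in the same way with the bounds in place
  of the complex numbers. Hence the triangle inequality loses nothing in the extremal case.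
  In the application \<open>X\<close>, \<open>Y\<close> and \<open>Z\<close> are the sums of the even coefficients.
\<close>

lemma norm_odd_odd_functional_le:
  fixes X Y Z :: complex and b L x y :: real
  assumes b: "b > 0" and L: "L \<ge> 1" "L * b \<ge> 1"
    and X: "cmod X \<le> x" and Y: "cmod Y \<le> y" and XYZ: "cmod (X * Y + X + Y - Z) \<le> x * y"
  shows "cmod (of_real L * (1 + of_real b * X) * (1 + of_real b * Y) - (1 + of_real b * Z))
           \<le> L * (1 + b * x) * (1 + b * y) - (1 + b * (x + y))"
proof -
  have nn: "0 \<le> x" "0 \<le> y"
    by (rule order_trans[OF norm_ge_zero X], rule order_trans[OF norm_ge_zero Y])
  have "of_real L * (1 + of_real b * X) * (1 + of_real b * Y) - (1 + of_real b * Z)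
      = of_real (L - 1) * (1 + of_real b * (X + Y)) + of_real (b * (L * b - 1)) * (X * Y)
        + of_real b * (X * Y + X + Y - Z)"
    by (simp add: algebra_simps)
  also have "cmod \<dots> \<le> (L - 1) * (1 + b * (x + y)) + b * (L * b - 1) * (x * y) + b * (x * y)"
  proof (rule norm_lincomb_le)
    have "cmod (1 + of_real b * (X + Y)) \<le> 1 + cmod (of_real b * (X + Y))"
      by (metis norm_one norm_triangle_ineq)
    also have "\<dots> = 1 + b * cmod (X + Y)"
      using b by (simp add: norm_mult)
    also have "\<dots> \<le> 1 + b * (x + y)"
      using b X Y by (intro add_mono mult_left_mono norm_triangle_mono) auto
    finally show "cmod (1 + of_real b * (X + Y)) \<le> 1 + b * (x + y)" .
    show "cmod (X * Y) \<le> x * y"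
      using X Y nn by (auto simp: norm_mult intro: mult_mono)
  qed (use b L XYZ in auto)
  also have "\<dots> = L * (1 + b * x) * (1 + b * y) - (1 + b * (x + y))"
    by (simp add: algebra_simps)
  finally show ?thesis .
qed

text \<open>
  The analogue for one even index; now \<open>X\<close> and \<open>Z\<close> are sums of odd coefficients, which have no
  constant term next to them.
\<close>

lemma norm_even_odd_functional_le:
  fixes X Y Z :: complex and b L x y :: real
  assumes b: "b > 0" and L: "L \<ge> 1" "L * b \<ge> 1"
    and X: "cmod X \<le> x" and Y: "cmod Y \<le> y" and XYZ: "cmod (X * Y + X - Z) \<le> x * y - y"
  shows "cmod (of_real L * (of_real b * X) * (1 + of_real b * Y) - of_real b * Z)
           \<le> L * (b * x) * (1 + b * y) - b * (x + y)"
proof -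
  have nn: "0 \<le> x" "0 \<le> y"
    by (rule order_trans[OF norm_ge_zero X], rule order_trans[OF norm_ge_zero Y])
  have "of_real L * (of_real b * X) * (1 + of_real b * Y) - of_real b * Z
      = of_real ((L - 1) * b) * X + of_real (b * (L * b - 1)) * (X * Y)
        + of_real b * (X * Y + X - Z)"
    by (simp add: algebra_simps)
  also have "cmod \<dots> \<le> (L - 1) * b * x + b * (L * b - 1) * (x * y) + b * (x * y - y)"
  proof (rule norm_lincomb_le)
    show "cmod (X * Y) \<le> x * y"
      using X Y nn by (auto simp: norm_mult intro: mult_mono)
  qed (use b L X XYZ in auto)
  also have "\<dots> = L * (b * x) * (1 + b * y) - b * (x + y)"
    by (simp add: algebra_simps)
  finally show ?thesis .
qed

section \<open>Coefficients of the class\<close>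

text \<open>
  An expansion leaves \<open>a 0\<close> and \<open>a 1\<close> unspecified; as a power series for \<open>f\<close> it needs the values
  0 and 1 there.
\<close>

lemma has_expansion_sums:
  assumes "has_expansion f a" "z \<in> ball 0 1"
  shows "(\<lambda>k. (a(0 := 0, 1 := 1)) k * z ^ k) sums f z"
proof -
  have "(\<lambda>k. (a(0 := 0, 1 := 1)) (k + 2) * z ^ (k + 2)) sums (f z - z)"
    using assms by (simp add: has_expansion_def)
  thus ?thesis
    by (subst (asm) sums_iff_shift) (simp add: numeral_2_eq_2)
qed

lemma sums_shift2:
  fixes d :: "nat \<Rightarrow> complex"
  assumes "(\<lambda>n. d n * z ^ n) sums s"
  shows "(\<lambda>n. (if n < 2 then 0 else d (n - 2)) * z ^ n) sums (z\<^sup>2 * s)"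
proof -
  have "(\<lambda>n. z\<^sup>2 * (d n * z ^ n)) sums (z\<^sup>2 * s)"
    by (rule sums_mult[OF assms])
  hence "(\<lambda>n. (\<lambda>n. (if n < 2 then 0 else d (n - 2)) * z ^ n) (n + 2)) sums (z\<^sup>2 * s)"
    by (simp add: power_add power2_eq_square mult_ac)
  thus ?thesis
    by (subst (asm) sums_iff_shift) (simp add: numeral_2_eq_2)
qed

text \<open>
  Comparing coefficients in \<open>(1 - z\<^sup>2) f' z = \<beta> + b p z\<close> shows that the coefficients \<open>d\<close> of \<open>f'\<close> satisfy
  \<open>d\<^sub>n\<^sub>+\<^sub>2 = d\<^sub>n + b c\<^sub>n\<^sub>+\<^sub>2\<close>, which is solved by summing over one parity class, starting at \<open>d\<^sub>0 = 1\<close>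
  and \<open>d\<^sub>1 = b c\<^sub>1\<close>.
\<close>

lemma class_F2_coefficients:
  assumes beta: "\<beta> < 1" and f: "f \<in> class_F2 \<beta>" and a: "has_expansion f a"
  obtains c where
    "\<And>k. k \<ge> 1 \<Longrightarrow> cmod (c k) \<le> 2"
    "\<And>i j. i \<ge> 1 \<Longrightarrow> j \<ge> 1 \<Longrightarrow> cmod (c i * c j - c (i + j)) \<le> 2"
    "\<And>l. l \<ge> 1 \<Longrightarrow> of_nat (2 * l + 1) * a (2 * l + 1) = 1 + of_real (1 - \<beta>) * even_coeff_sum c l"
    "\<And>k. k \<ge> 1 \<Longrightarrow> of_nat (2 * k) * a (2 * k) = of_real (1 - \<beta>) * odd_coeff_sum c k"
proof -
  define b where "b = complex_of_real (1 - \<beta>)"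
  have b: "b \<noteq> 0"
    using beta by (simp add: b_def)
  define d where "d = diffs (a(0 := 0, 1 := 1))"
  \<comment> \<open>\<open>q\<close> and \<open>c\<close> are the coefficients of \<open>(1 - z\<^sup>2) f'\<close> and of \<open>p\<close>.\<close>
  define q where "q n = d n - (if n < 2 then 0 else d (n - 2))" for n
  define c where "c n = (q n - of_real \<beta> * (if n = 0 then 1 else 0)) / b" for n
  define p where "p z = ((1 - z\<^sup>2) * deriv f z - of_real \<beta>) / b" for z
  have an: "f analytic_on ball 0 1"
    using f by (auto simp: class_F2_def class_A_def)
  have ps: "(\<lambda>n. c n * z ^ n) sums p z" if z: "z \<in> ball 0 1" for z
  proof -
    have "(f has_field_derivative deriv f z) (at z)"
      by (rule holomorphic_derivI[OF analytic_imp_holomorphic[OF an] open_ball z])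
    hence d: "(\<lambda>n. d n * z ^ n) sums deriv f z"
      unfolding d_def using z
      by (intro termdiffs_sums_strong[where K = 1 and f = f] has_expansion_sums[OF a]) auto
    have "(\<lambda>n. (d n * z ^ n - (if n < 2 then 0 else d (n - 2)) * z ^ n
             - of_real \<beta> * ((if n = 0 then 1 else 0) * z ^ n)) / b)
          sums ((deriv f z - z\<^sup>2 * deriv f z - of_real \<beta> * z ^ 0) / b)"
      by (intro sums_divide sums_diff d sums_shift2 sums_mult powser_sums_if)
    moreover have "(d n * z ^ n - (if n < 2 then 0 else d (n - 2)) * z ^ n
             - of_real \<beta> * ((if n = 0 then 1 else 0) * z ^ n)) / b = c n * z ^ n" for n
      by (simp add: c_def q_def algebra_simps)
    moreover have "(deriv f z - z\<^sup>2 * deriv f z - of_real \<beta> * z ^ 0) / b = p z"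
      by (simp add: p_def algebra_simps)
    ultimately show ?thesis
      by (simp only:)
  qed
  have d0: "d 0 = 1"
    by (simp add: d_def diffs_def)
  have c0: "c 0 = 1"
    using b by (simp add: c_def q_def d0 b_def)
  have pos: "Re (p z) > 0" if "z \<in> ball 0 1" for z
    using f that beta by (auto simp: class_F2_def p_def b_def simp del: of_real_diff)
  have rec: "d (n + 2) = d n + b * c (n + 2)" for n
    using b by (simp add: c_def q_def)
  have d_even: "d (2 * l) = 1 + b * even_coeff_sum c l" for l
  proof (induction l)
    case (Suc l)
    thus ?case
      using rec[of "2 * l"] by (simp add: even_coeff_sum_def algebra_simps)
  qed (simp add: d0 even_coeff_sum_def)
  have d_odd: "d (2 * k + 1) = b * odd_coeff_sum c (Suc k)" for k
  proof (induction k)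
    case 0
    show ?case
      using b by (simp add: odd_coeff_sum_def c_def q_def)
  next
    case (Suc k)
    thus ?case
      using rec[of "2 * k + 1"] by (simp add: odd_coeff_sum_def algebra_simps)
  qed
  show thesis
  proof (rule that)
    show "cmod (c k) \<le> 2" if "k \<ge> 1" for k
      by (rule caratheodory_coeff_bound[OF ps c0 pos that])
    show "cmod (c i * c j - c (i + j)) \<le> 2" if "i \<ge> 1" "j \<ge> 1" for i j
      by (rule livingston_inequality[OF ps c0 pos that])
    show "of_nat (2 * l + 1) * a (2 * l + 1) = 1 + of_real (1 - \<beta>) * even_coeff_sum c l"
      if "l \<ge> 1" for l
      using d_even[of l] that by (simp add: d_def diffs_def b_def)
    show "of_nat (2 * k) * a (2 * k) = of_real (1 - \<beta>) * odd_coeff_sum c k" if "k \<ge> 1" for k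
      using d_odd[of "k - 1"] that by (cases k) (simp_all add: d_def diffs_def b_def)
  qed
qed


lemma C_odd_mult:
  assumes "odd k"
  shows "real k * C \<beta> k = 1 + (real k - 1) * (1 - \<beta>)"
  using assms odd_pos[OF assms] by (simp add: C_def)

text \<open>
  The functional is symmetric in the two indices, so the odd one may be taken to be \<open>m\<close>. Passing
  from \<open>a n\<close> to \<open>n * a n\<close> and from \<open>\<mu>\<close> to \<open>L\<close> clears all denominators.
\<close>

lemma coefficient_functional_bound:
  fixes \<beta> \<mu> :: real and n m :: nat
  assumes beta: "\<beta> < 1" and n: "n \<ge> 2" and m: "m \<ge> 2" and m_odd: "odd m"
    and mu: "\<mu> \<ge> max (real n * real m / ((real n + real m - 1) * (1 - \<beta>)))
                  (real n * real m / (real n + real m - 1))"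
    and f: "f \<in> class_F2 \<beta>" and a: "has_expansion f a"
  shows "cmod (complex_of_real \<mu> * a n * a m - a (n + m - 1))
           \<le> \<mu> * C \<beta> n * C \<beta> m - C \<beta> (n + m - 1)"
proof -
  define b where "b = 1 - \<beta>"
  have b: "b > 0"
    using beta by (simp add: b_def)
  define N where "N = n + m - 1"
  have N: "real N = real n + real m - 1" "real N > 0"
    using n m by (simp_all add: N_def)
  define L where "L = \<mu> * real N / (real n * real m)"
  have nm: "real n > 0" "real m > 0"
    using n m by simp_all
  have L: "L \<ge> 1" "L * b \<ge> 1"
    using mu nm N(2) b unfolding L_def N(1)[symmetric] b_def[symmetric]
    by (simp_all add: field_simps)
  have mu_eq: "\<mu> = L * real n * real m / real N"
    using nm N(2) by (simp add: L_def)
  obtain c where b1: "\<And>k. k \<ge> 1 \<Longrightarrow> cmod (c k) \<le> 2"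
    and b2: "\<And>i j. i \<ge> 1 \<Longrightarrow> j \<ge> 1 \<Longrightarrow> cmod (c i * c j - c (i + j)) \<le> 2"
    and a_odd: "\<And>l. l \<ge> 1 \<Longrightarrow> of_nat (2 * l + 1) * a (2 * l + 1) = 1 + of_real b * even_coeff_sum c l"
    and a_even: "\<And>k. k \<ge> 1 \<Longrightarrow> of_nat (2 * k) * a (2 * k) = of_real b * odd_coeff_sum c k"
    using class_F2_coefficients[OF beta f a] unfolding b_def by metis
  let ?S = "even_coeff_sum c" and ?T = "odd_coeff_sum c"
  obtain l where l: "m = 2 * l + 1"
    using m_odd by (elim oddE)
  have l1: "l \<ge> 1"
    using l m by simp
  have C_odd: "real (2 * l + 1) * C \<beta> (2 * l + 1) = 1 + b * (2 * real l)" for l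
    by (subst C_odd_mult) (simp_all add: b_def)
  have C_even: "real (2 * k) * C \<beta> (2 * k) = b * (2 * real k)" for k
    by (simp add: C_def b_def algebra_simps)
  have "cmod (of_real L * (of_nat n * a n) * (of_nat m * a m) - of_nat N * a N)
      \<le> L * (real n * C \<beta> n) * (real m * C \<beta> m) - real N * C \<beta> N"
  proof (cases "even n")
    case True
    then obtain k where k: "n = 2 * k"
      by (elim evenE)
    have k1: "k \<ge> 1"
      using k n by simp
    have N': "N = 2 * (k + l)"
      by (simp add: N_def k l)
    have "cmod (of_real L * (of_real b * ?T k) * (1 + of_real b * ?S l) - of_real b * ?T (k + l))
        \<le> L * (b * (2 * real k)) * (1 + b * (2 * real l)) - b * (2 * real k + 2 * real l)"
    proof (intro norm_even_odd_functional_le b L norm_odd_coeff_sum_le norm_even_coeff_sum_le b1)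
      have "cmod (?T k * ?S l + ?T k - ?T (k + l)) \<le> 4 * real k * real l - 2 * real l"
        by (rule odd_even_coeff_sum_bound[OF b1 b2 k1])
      thus "cmod (?T k * ?S l + ?T k - ?T (k + l)) \<le> 2 * real k * (2 * real l) - 2 * real l"
        by simp
    qed
    also have "b * (2 * real k + 2 * real l) = b * (2 * real (k + l))"
      by simp
    finally show ?thesis
      unfolding k l N' a_even[OF k1] a_odd[OF l1] a_even[OF trans_le_add1[OF k1]] C_odd C_even .
  next
    case False
    then obtain k where k: "n = 2 * k + 1"
      by (elim oddE)
    have k1: "k \<ge> 1"
      using k n by simp
    have N': "N = 2 * (k + l) + 1"
      by (simp add: N_def k l)
    have "cmod (of_real L * (1 + of_real b * ?S k) * (1 + of_real b * ?S l) - (1 + of_real b * ?S (k + l)))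
        \<le> L * (1 + b * (2 * real k)) * (1 + b * (2 * real l)) - (1 + b * (2 * real k + 2 * real l))"
    proof (intro norm_odd_odd_functional_le b L norm_even_coeff_sum_le b1)
      have "cmod (?S k * ?S l + ?S k + ?S l - ?S (k + l)) \<le> 4 * real k * real l"
        by (rule even_even_coeff_sum_bound[OF b1 b2 l1])
      thus "cmod (?S k * ?S l + ?S k + ?S l - ?S (k + l)) \<le> 2 * real k * (2 * real l)"
        by simp
    qed
    also have "b * (2 * real k + 2 * real l) = b * (2 * real (k + l))"
      by simp
    finally show ?thesis
      unfolding k l N' a_odd[OF k1] a_odd[OF l1] a_odd[OF trans_le_add1[OF k1]] C_odd .
  qed
  also have "of_real L * (of_nat n * a n) * (of_nat m * a m) - of_nat N * a N
      = of_real (real N) * (of_real \<mu> * a n * a m - a N)"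
    using N(2) by (simp add: mu_eq right_diff_distrib)
  also have "L * (real n * C \<beta> n) * (real m * C \<beta> m) - real N * C \<beta> N
      = real N * (\<mu> * C \<beta> n * C \<beta> m - C \<beta> N)"
    using N(2) by (simp add: mu_eq right_diff_distrib)
  finally show ?thesis
    using N(2) unfolding norm_mult N_def[symmetric] by simp
qed

section \<open>The extremal function\<close>

definition extremal_coeff :: "real \<Rightarrow> nat \<Rightarrow> complex" where
  "extremal_coeff \<beta> k = (if k = 0 then 0 else of_real (C \<beta> k))"

lemma extremal_coeff_summable:
  assumes "\<beta> < 1" "cmod z < 1"
  shows "summable (\<lambda>k. extremal_coeff \<beta> k * z ^ k)"
proof (rule summable_comparison_test')
  show "summable (\<lambda>k. (1 + (1 - \<beta>)) * cmod z ^ k)"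
    using assms by (intro summable_mult summable_geometric) simp
  fix k :: nat
  have "\<bar>C \<beta> k\<bar> \<le> 1 + (1 - \<beta>)" if "k \<noteq> 0"
  proof (cases "odd k")
    case True
    have "1 + (real k - 1) * (1 - \<beta>) \<le> (1 + (1 - \<beta>)) * real k"
      using that assms by (simp add: algebra_simps)
    moreover have "0 \<le> 1 + (real k - 1) * (1 - \<beta>)"
      using that assms by (intro add_nonneg_nonneg mult_nonneg_nonneg) auto
    ultimately show ?thesis
      using that True by (simp add: C_def abs_le_iff divide_le_eq)
  qed (use assms in \<open>simp add: C_def\<close>)
  thus "norm (extremal_coeff \<beta> k * z ^ k) \<le> (1 + (1 - \<beta>)) * cmod z ^ k"
    using assms
    by (cases "k = 0") (auto simp: extremal_coeff_def norm_mult norm_power intro!: mult_right_mono)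
qed

text \<open>
  The term \<open>(1 + (- 1) ^ n) / 2\<close> is the indicator of the even \<open>n\<close>; in this form the series of the
  derivative is a combination of geometric series.
\<close>

lemma diffs_extremal_coeff:
  "diffs (extremal_coeff \<beta>) n = of_real (1 - \<beta>) * of_nat (Suc n) + of_real (\<beta> / 2) * (1 + (- 1) ^ n)"
proof (cases "even n")
  case True
  have "diffs (extremal_coeff \<beta>) n = of_real (real (Suc n) * C \<beta> (Suc n))"
    by (simp add: diffs_def extremal_coeff_def)
  also have "real (Suc n) * C \<beta> (Suc n) = (1 - \<beta>) * real (Suc n) + \<beta> / 2 * (1 + (- 1) ^ n)"
    using True by (subst C_odd_mult) (simp_all add: algebra_simps)
  finally show ?thesis by simp
qed (simp add: diffs_def extremal_coeff_def C_def)

lemma extremal_derivative_sums: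
  assumes z: "cmod z < 1"
  shows "(\<lambda>n. diffs (extremal_coeff \<beta>) n * z ^ n)
           sums (of_real (1 - \<beta>) / (1 - z)\<^sup>2 + of_real \<beta> / (1 - z\<^sup>2))"
proof -
  have "(\<lambda>n. of_real (1 - \<beta>) * (of_nat (Suc n) * z ^ n) + of_real (\<beta> / 2) * (z ^ n + (- z) ^ n))
     sums (of_real (1 - \<beta>) * (1 / (1 - z)\<^sup>2) + of_real (\<beta> / 2) * (1 / (1 - z) + 1 / (1 - (- z))))"
    using z by (intro sums_add sums_mult geometric_deriv_sums geometric_sums) auto
  moreover have "of_real (1 - \<beta>) * (of_nat (Suc n) * z ^ n) + of_real (\<beta> / 2) * (z ^ n + (- z) ^ n)
      = diffs (extremal_coeff \<beta>) n * z ^ n" for n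
    unfolding diffs_extremal_coeff power_minus[of z] by (simp add: algebra_simps)
  moreover have "of_real (1 - \<beta>) * (1 / (1 - z)\<^sup>2) + of_real (\<beta> / 2) * (1 / (1 - z) + 1 / (1 - (- z)))
      = of_real (1 - \<beta>) / (1 - z)\<^sup>2 + of_real \<beta> / (1 - z\<^sup>2)"
  proof -
    have "1 - z \<noteq> 0" "1 + z \<noteq> 0"
      using z by (auto simp: add_eq_0_iff)
    moreover have "1 - z\<^sup>2 = (1 - z) * (1 + z)"
      by (simp add: power2_eq_square algebra_simps)
    ultimately have "1 / (1 - z) + 1 / (1 - (- z)) = 2 / (1 - z\<^sup>2)"
      by (simp add: divide_simps)
    thus ?thesis by simp
  qed
  ultimately show ?thesis
    by (simp only:)
qed

lemma cayley_transform_Re_pos: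
  assumes "cmod z < 1"
  shows "Re ((1 + z) / (1 - z)) > 0"
proof -
  have "(cmod z)\<^sup>2 < 1"
    using assms by (simp add: power_less_one_iff abs_square_less_1)
  hence "(Re z)\<^sup>2 + (Im z)\<^sup>2 < 1"
    by (simp add: cmod_power2)
  moreover have "z \<noteq> 1"
    using assms by auto
  hence "(1 - Re z)\<^sup>2 + (Im z)\<^sup>2 > 0"
    by (metis cmod_power2 minus_complex.simps one_complex.simps zero_less_norm_iff zero_less_power
        right_minus_eq power2_minus diff_0)
  ultimately show ?thesis
    by (simp add: Re_divide power2_eq_square algebra_simps)
qed

text \<open>
  Multiplying the derivative by \<open>1 - z\<^sup>2 = (1 - z) (1 + z)\<close> gives
  \<open>\<beta> + (1 - \<beta>) (1 + z) / (1 - z)\<close>, and the Cayley transform has positive real part.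
\<close>

lemma extremal_function_in_class_F2:
  assumes beta: "\<beta> < 1"
  shows "\<exists>f. f \<in> class_F2 \<beta> \<and> has_expansion f (extremal_coeff \<beta>)"
proof -
  define f where "f z = (\<Sum>k. extremal_coeff \<beta> k * z ^ k)" for z
  have sums: "(\<lambda>k. extremal_coeff \<beta> k * z ^ k) sums f z" if "z \<in> ball 0 1" for z
    unfolding f_def using extremal_coeff_summable[OF beta, of z] that by (auto intro: summable_sums)
  have exp: "has_expansion f (extremal_coeff \<beta>)"
    unfolding has_expansion_def
  proof
    fix z :: complex
    assume "z \<in> ball 0 1"
    from sums[OF this] show "(\<lambda>k. extremal_coeff \<beta> (k + 2) * z ^ (k + 2)) sums (f z - z)"
      by (subst sums_iff_shift) (simp add: numeral_2_eq_2 extremal_coeff_def C_def)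
  qed
  have "f analytic_on ball 0 1"
    using power_series_imp_holomorphic[OF sums] by (simp add: analytic_on_open)
  moreover have "Re ((1 - z\<^sup>2) * deriv f z) > \<beta>" if "z \<in> ball 0 1" for z
  proof -
    have z: "cmod z < 1"
      using that by simp
    have "(f has_field_derivative (\<Sum>n. diffs (extremal_coeff \<beta>) n * z ^ n)) (at z)"
      unfolding f_def by (rule termdiffs_strong'[OF extremal_coeff_summable[OF beta] z])
    hence deriv: "deriv f z = of_real (1 - \<beta>) / (1 - z)\<^sup>2 + of_real \<beta> / (1 - z\<^sup>2)"
      using sums_unique[OF extremal_derivative_sums[OF z, of \<beta>]] by (simp only: DERIV_imp_deriv)
    have nz: "1 - z \<noteq> 0" "1 + z \<noteq> 0"
      using z by (auto simp: add_eq_0_iff)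
    have factor: "1 - z\<^sup>2 = (1 - z) * (1 + z)"
      by (simp add: power2_eq_square algebra_simps)
    have "(1 - z\<^sup>2) * (of_real (1 - \<beta>) / (1 - z)\<^sup>2) = of_real (1 - \<beta>) * ((1 + z) / (1 - z))"
      using nz unfolding factor by (simp add: power2_eq_square del: of_real_diff)
    moreover have "(1 - z\<^sup>2) * (of_real \<beta> / (1 - z\<^sup>2)) = of_real \<beta>"
      using nz unfolding factor by simp
    ultimately have "(1 - z\<^sup>2) * deriv f z = of_real (1 - \<beta>) * ((1 + z) / (1 - z)) + of_real \<beta>"
      unfolding deriv distrib_left by (simp only:)
    moreover have "Re (of_real (1 - \<beta>) * w + of_real \<beta>) = (1 - \<beta>) * Re w + \<beta>" for w
      by simp
    ultimately have "Re ((1 - z\<^sup>2) * deriv f z) = (1 - \<beta>) * Re ((1 + z) / (1 - z)) + \<beta>"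
      by (simp only:)
    moreover have "(1 - \<beta>) * Re ((1 + z) / (1 - z)) > 0"
      using beta by (intro mult_pos_pos cayley_transform_Re_pos[OF z]) simp
    ultimately show ?thesis
      by linarith
  qed
  ultimately show ?thesis
    using exp by (auto simp: class_F2_def class_A_def)
qed

theorem theorem4p3:
  fixes \<beta> \<mu> :: real and n m :: nat
  assumes "\<beta> < 1"
    and "n \<ge> 2" and "m \<ge> 2"
    and "\<not> (even n \<and> even m)"
    and "\<mu> \<ge> max (real n * real m / ((real n + real m - 1) * (1 - \<beta>)))
                  (real n * real m / (real n + real m - 1))"
  shows "(\<forall>f a. f \<in> class_F2 \<beta> \<longrightarrow> has_expansion f a \<longrightarrow>
            cmod (complex_of_real \<mu> * a n * a m - a (n + m - 1))
              \<le> \<mu> * C \<beta> n * C \<beta> m - C \<beta> (n + m - 1))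
       \<and> (\<exists>f a. f \<in> class_F2 \<beta> \<and> has_expansion f a \<and>
            cmod (complex_of_real \<mu> * a n * a m - a (n + m - 1))
              = \<mu> * C \<beta> n * C \<beta> m - C \<beta> (n + m - 1))"
proof -
  have bound: "cmod (complex_of_real \<mu> * a n * a m - a (n + m - 1))
      \<le> \<mu> * C \<beta> n * C \<beta> m - C \<beta> (n + m - 1)"
    if fa: "f \<in> class_F2 \<beta>" "has_expansion f a" for f a
  proof (cases "odd m")
    case True
    thus ?thesis
      using coefficient_functional_bound[OF assms(1-3) _ assms(5) fa] by blast
  next
    case False
    hence "odd n"
      using assms(4) by blast
    moreover have "\<mu> \<ge> max (real m * real n / ((real m + real n - 1) * (1 - \<beta>)))
                  (real m * real n / (real m + real n - 1))"
      using assms(5) by (simp add: add.commute mult.commute)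
    ultimately have "cmod (complex_of_real \<mu> * a m * a n - a (m + n - 1))
        \<le> \<mu> * C \<beta> m * C \<beta> n - C \<beta> (m + n - 1)"
      using coefficient_functional_bound[OF assms(1) assms(3) assms(2) _ _ fa] by blast
    thus ?thesis
      by (simp add: ac_simps)
  qed
  obtain f where f: "f \<in> class_F2 \<beta>" "has_expansion f (extremal_coeff \<beta>)"
    using extremal_function_in_class_F2[OF assms(1)] by blast
  \<comment> \<open>At the extremal function the functional is the real number \<open>?R\<close>, and the bound, applied to that
      function, shows that \<open>?R\<close> is nonnegative.\<close>
  let ?a = "extremal_coeff \<beta>"
  let ?R = "\<mu> * C \<beta> n * C \<beta> m - C \<beta> (n + m - 1)"
  have "complex_of_real \<mu> * ?a n * ?a m - ?a (n + m - 1) = of_real ?R"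
    using assms(2,3) by (simp add: extremal_coeff_def)
  moreover have "0 \<le> ?R"
    by (rule order_trans[OF norm_ge_zero bound[OF f]])
  ultimately have "cmod (complex_of_real \<mu> * ?a n * ?a m - ?a (n + m - 1)) = ?R"
    by (simp only: norm_of_real abs_of_nonneg)
  thus ?thesis
    using bound f by blast
qed

end
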